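(* Consider the Round-Robin protocol with $n$ agents over a finite item set $M$, as described in the context. Let $i$ be an agent with a normalized, nonnegative, monotone submodular objective $f_i$ and a $p_i$-system constraint $\mathcal{I}_i$, who follows the greedy policy, ending with set $S_i$. Let $j\neq i$ be any other agent (following an arbitrary policy), let $S_j$ be the set of items selected by agent $j$ during the protocol, and let $g$ be the first item selected by agent $j$. Define $S'_j=S_j$ if $i<j$ and $S'_j=S_j\setminus\{g\}$ otherwise. Then $f_i(S_i)\ge \max_{S\in\mathcal{I}_i|S'_j} f_i(S)/(p_i+2)$.
   Context: For $f:2^M\to\mathbb{R}$ write $f(x\,|\,S)=f(S\cup\{x\})-f(S)$; submodular means $f(x\,|\,S)\ge f(x\,|\,T)$ for $S\subseteq T$, $x\notin T$. An independence system is a family $\mathcal{I}\subseteq 2^M$ containing $\emptyset$ and closed under subsets; a basis of $S$ is a maximal member of $\mathcal{I}$ contained in $S$; $\mathrm{ur}(S)$, $\mathrm{lr}(S)$ are the largest and smallest basis cardinalities of $S$; a $p$-system is an independence system with $\max_{S\subseteq M}\mathrm{ur}(S)/\mathrm{lr}(S)\le p$. For $A\subseteq M$, $\mathcal{I}|A=\{X\cap A: X\in\mathcal{I}\}$. Round-Robin protocol: $|M|=m$; initially the available set is $Q=M$; for rounds $r=1,\dots,\lceil m/n\rceil$ and within each round for agents $1,\dots,n$ in order, the current agent (by an arbitrary policy possibly using full information) either selects one item of $Q$, which is removed from $Q$, or selects nothing. Greedy policy of agent $i$: maintain $S_i$ (initially $\emptyset$); at each turn let $A=\{x\in Q: S_i\cup\{x\}\in\mathcal{I}_i\}$;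 if $A\neq\emptyset$ select some $j\in\arg\max_{x\in A}f_i(x\,|\,S_i)$ and add it to $S_i$, otherwise select nothing. *)

theory Defs
  imports Complex_Main
begin

text \<open>Set functions on the subsets of \<open>M\<close> are total functions on sets; only their values on
  \<open>Pow M\<close> are constrained.\<close>

definition marginal :: "('a set \<Rightarrow> real) \<Rightarrow> 'a \<Rightarrow> 'a set \<Rightarrow> real" where
  "marginal f x S = f (S \<union> {x}) - f S"

definition submodular_on :: "'a set \<Rightarrow> ('a set \<Rightarrow> real) \<Rightarrow> bool" where
  "submodular_on M f \<longleftrightarrow>
     (\<forall>S T x. S \<subseteq> T \<and> T \<subseteq> M \<and> x \<in> M - T \<longrightarrow> marginal f x S \<ge> marginal f x T)"

definition independence_system :: "'a set \<Rightarrow> 'a set set \<Rightarrow> bool" where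
  "independence_system M \<I> \<longleftrightarrow>
     \<I> \<subseteq> Pow M \<and> {} \<in> \<I> \<and> (\<forall>X\<in>\<I>. \<forall>Y. Y \<subseteq> X \<longrightarrow> Y \<in> \<I>)"

definition basis_of :: "'a set set \<Rightarrow> 'a set \<Rightarrow> 'a set \<Rightarrow> bool" where
  "basis_of \<I> S B \<longleftrightarrow>
     B \<in> \<I> \<and> B \<subseteq> S \<and> (\<forall>B'\<in>\<I>. B \<subseteq> B' \<and> B' \<subseteq> S \<longrightarrow> B' = B)"

definition ur :: "'a set set \<Rightarrow> 'a set \<Rightarrow> nat" where
  "ur \<I> S = Max (card ` {B. basis_of \<I> S B})"

definition lr :: "'a set set \<Rightarrow> 'a set \<Rightarrow> nat" where
  "lr \<I> S = Min (card ` {B. basis_of \<I> S B})"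

text \<open>If \<open>lr \<I> S = 0\<close> then the empty set is the only basis of \<open>S\<close>, so \<open>ur \<I> S = 0\<close> as well; such
  sets contribute \<open>0 / 0 = 0\<close> and impose nothing beyond \<open>p \<ge> 0\<close>. As soon as \<open>\<I>\<close> has a nonempty
  member, the maximum is at least 1. The parameter \<open>p\<close> need not be an integer.\<close>

definition p_system :: "'a set \<Rightarrow> real \<Rightarrow> 'a set set \<Rightarrow> bool" where
  "p_system M p \<I> \<longleftrightarrow>
     independence_system M \<I> \<and> (MAX S\<in>Pow M. real (ur \<I> S) / real (lr \<I> S)) \<le> p"

definition restrict_system :: "'a set set \<Rightarrow> 'a set \<Rightarrow> 'a set set" where
  "restrict_system \<I> A = {X \<inter> A | X. X \<in> \<I>}"

text \<open>A history lists the outcomes of the turns taken so far, oldest first: \<open>Some x\<close> if \<open>x\<close> was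
  selected, \<open>None\<close> if nothing was. Turns are counted from 0, agents from 1, so turn \<open>t\<close> belongs to
  agent \<open>t mod n + 1\<close> and lies in round \<open>t div n + 1\<close>; \<open>nths\<close> likewise indexes from 0.

  A policy may depend on the whole history. All other data (the objectives, constraints and
  policies of all agents) are fixed parameters which it may also depend on. A randomized policy
  is covered realization by realization.\<close>

type_synonym 'a history = "'a option list"
type_synonym 'a policy = "'a history \<Rightarrow> 'a option"

definition turn_agent :: "nat \<Rightarrow> nat \<Rightarrow> nat" where
  "turn_agent n t = t mod n + 1"

definition available :: "'a set \<Rightarrow> 'a history \<Rightarrow> 'a set" where
  "available M h = M - {x. Some x \<in> set h}"

definition picks :: "nat \<Rightarrow> nat \<Rightarrow> 'a history \<Rightarrow> 'a list" where
  "picks n k h = map the (filter (\<lambda>c. c \<noteq> None) (nths h {t. turn_agent n t = k}))"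

definition admissible_policy :: "'a set \<Rightarrow> 'a policy \<Rightarrow> bool" where
  "admissible_policy M \<pi> \<longleftrightarrow> (\<forall>h. \<pi> h = None \<or> (\<exists>x \<in> available M h. \<pi> h = Some x))"

text \<open>Ties between maximizers may be broken arbitrarily.\<close>

definition greedy_policy ::
  "'a set \<Rightarrow> nat \<Rightarrow> ('a set \<Rightarrow> real) \<Rightarrow> 'a set set \<Rightarrow> nat \<Rightarrow> 'a policy \<Rightarrow> bool" where
  "greedy_policy M n f \<I> i \<pi> \<longleftrightarrow>
     (\<forall>h. let S = set (picks n i h);
              A = {x \<in> available M h. S \<union> {x} \<in> \<I>}
          in if A \<noteq> {}
             then \<exists>x. is_arg_max (\<lambda>y. marginal f y S) (\<lambda>y. y \<in> A) x \<and> \<pi> h = Some x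
             else \<pi> h = None)"

primrec run :: "nat \<Rightarrow> (nat \<Rightarrow> 'a policy) \<Rightarrow> nat \<Rightarrow> 'a history" where
  "run n \<pi> 0 = []"
| "run n \<pi> (Suc t) = run n \<pi> t @ [\<pi> (turn_agent n t) (run n \<pi> t)]"

definition num_rounds :: "'a set \<Rightarrow> nat \<Rightarrow> nat" where
  "num_rounds M n = nat \<lceil>real (card M) / real n\<rceil>"

definition round_robin :: "'a set \<Rightarrow> nat \<Rightarrow> (nat \<Rightarrow> 'a policy) \<Rightarrow> 'a history" where
  "round_robin M n \<pi> = run n \<pi> (num_rounds M n * n)"

end

theory Submission
  imports Defs
begin

text \<open>Fix a feasible set \<open>Z\<close> inside \<open>S\<^sub>j'\<close> and call an element of \<open>Z\<close> blocked before round \<open>r\<close> if it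
  is already taken when agent \<open>i\<close> moves or can no longer be added to the greedy set \<open>P r\<close>. At most
  \<open>r\<close> elements have been taken by agent \<open>j\<close> (this is where the first item is discarded if \<open>j < i\<close>),
  and at most \<open>p * r\<close> are infeasible, because \<open>P r\<close> is a basis of its union with them. An element
  that becomes blocked in round \<open>r\<close> was a candidate in that round, so its marginal value is at most
  the gain of the greedy step. The gains decrease, so summation by parts bounds the total marginal
  value of \<open>Z\<close> over the final greedy set by \<open>(p + 1) * f S\<^sub>i\<close>.\<close>

section \<open>Monotone submodular functions\<close>

lemma submodular_on_marginal_antimono:
  assumes "submodular_on M f" and "mono_on (Pow M) f" and "S \<subseteq> T" and "T \<subseteq> M" and "x \<in> M"
  shows "marginal f x T \<le> marginal f x S"
proof (cases "x \<in> T")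
  case True
  \<comment> \<open>For \<open>x\<close> in \<open>T\<close> the marginal over \<open>T\<close> is
    zero and monotonicity suffices; \<open>submodular_on\<close> speaks only of \<open>x\<close>
    outside \<open>T\<close>.\<close>
  have "f S \<le> f (S \<union> {x})"
    using assms by (intro mono_onD[OF assms(2)]) auto
  with True show ?thesis
    by (simp add: marginal_def insert_absorb)
next
  case False
  with assms show ?thesis
    unfolding submodular_on_def by blast
qed

lemma submodular_on_le_sum_marginal:
  assumes "submodular_on M f" and "mono_on (Pow M) f"
    and "finite B" and "S \<subseteq> M" and "B \<subseteq> M"
  shows "f (S \<union> B) \<le> f S + (\<Sum>x\<in>B. marginal f x S)"
  using assms(3,5)
proof (induction B rule: finite_induct)
  case empty
  then show ?case by simp
next
  case (insert x B)
  have "marginal f x (S \<union> B) \<le> marginal f x S"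
    using insert.prems assms by (intro submodular_on_marginal_antimono) auto
  moreover have "f (S \<union> insert x B) = f (S \<union> B) + marginal f x (S \<union> B)"
    by (simp add: marginal_def)
  ultimately show ?case
    using insert by simp
qed

section \<open>Basis sizes in p-systems\<close>

lemma independence_system_extend_basis:
  assumes "finite M" and "independence_system M \<I>" and "C \<in> \<I>" and "C \<subseteq> T"
  obtains B where "basis_of \<I> T B" and "C \<subseteq> B"
proof -
  let ?F = "{X \<in> \<I>. X \<subseteq> T}"
  have "finite ?F"
    using assms(1,2) by (auto simp: independence_system_def intro: finite_subset[of _ "Pow M"])
  with assms obtain B where "B \<in> ?F" "C \<subseteq> B" "\<forall>X\<in>?F. B \<subseteq> X \<longrightarrow> B = X"
    using finite_has_maximal2[of ?F C] by blast
  then show thesis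
    by (intro that[of B]) (auto simp: basis_of_def)
qed

lemma p_system_nonneg:
  assumes "finite M" and "p_system M p \<I>"
  shows "0 \<le> p"
proof -
  have "real (ur \<I> {}) / real (lr \<I> {}) \<le> (MAX S\<in>Pow M. real (ur \<I> S) / real (lr \<I> S))"
    using assms(1) by (intro Max_ge) auto
  moreover have "0 \<le> real (ur \<I> {}) / real (lr \<I> {})" by simp
  ultimately show ?thesis
    using assms(2) unfolding p_system_def by linarith
qed

text \<open>Extending \<open>C\<close> to a basis of \<open>T\<close> bounds its size by
  \<open>ur\<close>, while \<open>B\<close> has size at least \<open>lr\<close>.\<close>

lemma p_system_card_le_basis:
  assumes M: "finite M" and p: "p_system M p \<I>" and T: "T \<subseteq> M"
    and B: "basis_of \<I> T B" and C: "C \<in> \<I>" "C \<subseteq> T"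
  shows "real (card C) \<le> p * real (card B)"
proof -
  have ind: "independence_system M \<I>" using p by (simp add: p_system_def)
  obtain D where D: "basis_of \<I> T D" "C \<subseteq> D"
    using independence_system_extend_basis[OF M ind C] .
  have finT: "finite T" using M T by (rule finite_subset[rotated])
  have "{B. basis_of \<I> T B} \<subseteq> Pow T" by (auto simp: basis_of_def)
  then have fin: "finite {B. basis_of \<I> T B}"
    using finT by (meson finite_Pow_iff finite_subset)
  have "finite D" using D(1) finT by (auto simp: basis_of_def intro: finite_subset)
  then have "card C \<le> card D" using D(2) by (rule card_mono)
  also have "card D \<le> ur \<I> T"
    unfolding ur_def using fin D(1) by (intro Max_ge) auto
  finally have C_ur: "card C \<le> ur \<I> T" .
  have lr_B: "lr \<I> T \<le> card B"
    unfolding lr_def using fin B by (intro Min_le) auto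
  show ?thesis
  proof (cases "lr \<I> T = 0")
    \<comment> \<open>Here the ratio is \<open>0\<close> by the convention for division by zero and
      carries no information. Instead, the empty set is a basis, and its maximality forces
      \<open>C\<close> to be empty.\<close>
    case True
    have "lr \<I> T \<in> card ` {B. basis_of \<I> T B}"
      unfolding lr_def using fin B by (intro Min_in) auto
    then obtain E where "basis_of \<I> T E" "card E = 0" using True by auto
    moreover from this have "E = {}"
      using finT by (auto simp: basis_of_def dest: finite_subset)
    ultimately have "C = {}" using C by (auto simp: basis_of_def)
    then show ?thesis using p_system_nonneg[OF M p] by simp
  next
    case False
    have "real (ur \<I> T) / real (lr \<I> T) \<le> (MAX S\<in>Pow M. real (ur \<I> S) / real (lr \<I> S))"
      using M T by (intro Max_ge) auto
    also have "\<dots> \<le> p" using p by (simp add: p_system_def)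
    finally have "real (ur \<I> T) \<le> p * real (lr \<I> T)"
      using False by (simp add: divide_simps)
    also have "\<dots> \<le> p * real (card B)"
      using lr_B p_system_nonneg[OF M p] by (intro mult_left_mono) auto
    finally show ?thesis using C_ur by linarith
  qed
qed

text \<open>\<open>P\<close> is a basis of its union with the blocked elements, which form an
  independent set as a part of \<open>Z\<close>; the two sizes can therefore be compared.\<close>

lemma p_system_card_blocked:
  assumes M: "finite M" and p: "p_system M p \<I>" and P: "P \<in> \<I>" and Z: "Z \<in> \<I>"
  shows "real (card {x \<in> Z. insert x P \<notin> \<I>}) \<le> p * real (card P)"
proof -
  let ?C = "{x \<in> Z. insert x P \<notin> \<I>}"
  have sub: "\<I> \<subseteq> Pow M" and down: "\<And>X Y. X \<in> \<I> \<Longrightarrow> Y \<subseteq> X \<Longrightarrow> Y \<in> \<I>"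
    using p by (auto simp: p_system_def independence_system_def)
  have "basis_of \<I> (P \<union> ?C) P"
    unfolding basis_of_def
  proof (intro conjI ballI impI)
    fix X assume X: "X \<in> \<I>" "P \<subseteq> X \<and> X \<subseteq> P \<union> ?C"
    have "x \<in> P" if "x \<in> X" for x
      using X that down[OF X(1), of "insert x P"] by auto
    with X show "X = P" by auto
  qed (use P in auto)
  moreover have "?C \<in> \<I>" using Z by (rule down) auto
  ultimately show ?thesis
    using sub P Z by (intro p_system_card_le_basis[OF M p, of "P \<union> ?C"]) auto
qed

section \<open>Charging along an abstract greedy sequence\<close>

lemma sum_by_parts_le:
  fixes u \<delta> :: "nat \<Rightarrow> real"
  assumes "u 0 = 0" and "\<And>r. r \<le> R \<Longrightarrow> u r \<le> c * r"
    and "\<And>r. \<delta> (Suc r) \<le> \<delta> r" and "\<And>r. 0 \<le> \<delta> r"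
  shows "(\<Sum>r<R. (u (Suc r) - u r) * \<delta> r) \<le> c * (\<Sum>r<R. \<delta> r)"
proof -
  have "(\<Sum>r<s. (u (Suc r) - u r) * \<delta> r) + (c * s - u s) * \<delta> s \<le> c * (\<Sum>r<s. \<delta> r)"
    if "s \<le> R" for s
    using that
  proof (induction s)
    case 0
    then show ?case using assms(1) by simp
  next
    case (Suc s)
    have "(c * Suc s - u (Suc s)) * \<delta> (Suc s) \<le> (c * Suc s - u (Suc s)) * \<delta> s"
      using assms(2)[OF Suc.prems] assms(3) by (intro mult_left_mono) auto
    with Suc show ?case by (simp add: algebra_simps)
  qed
  from this[of R] have "(\<Sum>r<R. (u (Suc r) - u r) * \<delta> r) + (c * R - u R) * \<delta> R \<le> c * (\<Sum>r<R. \<delta> r)"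
    by simp
  moreover have "0 \<le> (c * R - u R) * \<delta> R"
    using assms(2)[of R] assms(4)[of R] by simp
  ultimately show ?thesis by linarith
qed

text \<open>This isolates what the protocol must supply: a shrinking pool \<open>Q\<close> that has
  lost at most \<open>r\<close> elements of \<open>Z\<close> by step \<open>r\<close> and all of
  them by step \<open>R\<close>.\<close>

lemma greedy_sequence_bound:
  fixes P Q :: "nat \<Rightarrow> 'a set"
  assumes M: "finite M" and f0: "f {} = 0" and mono: "mono_on (Pow M) f"
    and sm: "submodular_on M f" and p: "p_system M p \<I>"
    and P0: "P 0 = {}" and QM: "\<And>r. Q r \<subseteq> M" and Qdec: "\<And>r. Q (Suc r) \<subseteq> Q r"
    and stop: "\<And>r. {x \<in> Q r. insert x (P r) \<in> \<I>} = {} \<Longrightarrow> P (Suc r) = P r"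
    and step: "\<And>r. {x \<in> Q r. insert x (P r) \<in> \<I>} \<noteq> {} \<Longrightarrow>
      \<exists>x. P (Suc r) = insert x (P r) \<and>
        is_arg_max (\<lambda>y. marginal f y (P r)) (\<lambda>y. y \<in> {x \<in> Q r. insert x (P r) \<in> \<I>}) x"
    and Z: "Z \<in> \<I>" and taken: "\<And>r. r \<le> R \<Longrightarrow> card (Z - Q r) \<le> r" and gone: "Z \<inter> Q R = {}"
  shows "f Z \<le> (p + 2) * f (P R)"
proof -
  define A where "A r = {x \<in> Q r. insert x (P r) \<in> \<I>}" for r
  define \<delta> where "\<delta> r = f (P (Suc r)) - f (P r)" for r
  \<comment> \<open>The complement of the candidates merges both reasons for being blocked, taken or
    infeasible. It grows from the empty set at \<open>0\<close> to \<open>Z\<close> at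
    \<open>R\<close>.\<close>
  define U where "U r = {x \<in> Z. x \<notin> A r}" for r
  have sub: "\<I> \<subseteq> Pow M" and emp: "{} \<in> \<I>" and down: "\<And>X Y. X \<in> \<I> \<Longrightarrow> Y \<subseteq> X \<Longrightarrow> Y \<in> \<I>"
    using p by (auto simp: p_system_def independence_system_def)
  have OM: "Z \<subseteq> M" and finO: "finite Z"
    using Z sub M by (auto intro: finite_subset)
  have AM: "A r \<subseteq> M" for r using QM by (auto simp: A_def)
  have cases_step: "(A r = {} \<and> P (Suc r) = P r) \<or>
      (\<exists>x\<in>A r. P (Suc r) = insert x (P r) \<and> (\<forall>y\<in>A r. marginal f y (P r) \<le> marginal f x (P r)))" for r
    using stop[of r] step[of r] unfolding A_def[symmetric]
    by (fastforce simp: is_arg_max_def not_less)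
  have PI: "P r \<in> \<I>" for r
  proof (induction r)
    case (Suc r)
    then show ?case using cases_step[of r] by (auto simp: A_def)
  qed (simp add: P0 emp)
  have PM: "P r \<subseteq> M" for r using PI sub by blast
  have Pmono: "r \<le> s \<Longrightarrow> P r \<subseteq> P s" for r s
    by (rule lift_Suc_mono_le) (use cases_step in blast)+
  have card_P: "card (P r) \<le> r" for r
  proof (induction r)
    case (Suc r)
    then show ?case
      using cases_step[of r] card_insert_le_m1[of "Suc r" "P r"] by auto
  qed (simp add: P0)
  have A_dec: "A (Suc r) \<subseteq> A r" for r
    using Qdec[of r] Pmono[of r "Suc r"] by (auto simp: A_def intro: down)
  have gain: "marginal f y (P r) \<le> \<delta> r" if "y \<in> A r" for y r
    using cases_step[of r] that by (auto simp: \<delta>_def marginal_def)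
  have \<delta>_nonneg: "0 \<le> \<delta> r" for r
    using mono_onD[OF mono, of "P r" "P (Suc r)"] PM Pmono[of r "Suc r"] by (simp add: \<delta>_def)
  \<comment> \<open>The next greedy choice was already a candidate one step earlier, with a marginal
    at least as large.\<close>
  have \<delta>_dec: "\<delta> (Suc r) \<le> \<delta> r" for r
  proof (cases "A (Suc r) = {}")
    case True
    then have "\<delta> (Suc r) = 0" using cases_step[of "Suc r"] by (auto simp: \<delta>_def)
    then show ?thesis using \<delta>_nonneg by simp
  next
    case False
    then obtain x where x: "x \<in> A (Suc r)" "P (Suc (Suc r)) = insert x (P (Suc r))"
      using cases_step[of "Suc r"] by auto
    then have "\<delta> (Suc r) = marginal f x (P (Suc r))" by (simp add: \<delta>_def marginal_def)
    also have "\<dots> \<le> marginal f x (P r)"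
      using x AM Pmono[of r "Suc r"] PM by (intro submodular_on_marginal_antimono[OF sm mono]) auto
    also have "\<dots> \<le> \<delta> r" using x A_dec by (intro gain) auto
    finally show ?thesis .
  qed
  have sum_\<delta>: "(\<Sum>r<s. \<delta> r) = f (P s)" for s
    by (induction s) (simp_all add: \<delta>_def P0 f0)
  have finU: "finite (U r)" for r using finO by (simp add: U_def)
  have U_mono: "U r \<subseteq> U (Suc r)" for r using A_dec by (auto simp: U_def)
  \<comment> \<open>The bound \<open>taken\<close> at \<open>0\<close> leaves all of
    \<open>Z\<close> in the pool, and singletons from \<open>Z\<close> are independent, so nothing
    is blocked initially.\<close>
  have "Z - Q 0 = {}" using taken[of 0] finO by simp
  then have U_0: "U 0 = {}" using Z by (auto simp: U_def A_def P0 intro: down)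
  have U_R: "U R = Z" using gone by (auto simp: U_def A_def)
  have U_card: "real (card (U r)) \<le> (p + 1) * r" if "r \<le> R" for r
  proof -
    have "U r \<subseteq> {x \<in> Z. insert x (P r) \<notin> \<I>} \<union> (Z - Q r)" by (auto simp: U_def A_def)
    then have "card (U r) \<le> card ({x \<in> Z. insert x (P r) \<notin> \<I>} \<union> (Z - Q r))"
      using finO by (intro card_mono) auto
    also have "\<dots> \<le> card {x \<in> Z. insert x (P r) \<notin> \<I>} + card (Z - Q r)" by (rule card_Un_le)
    finally have "real (card (U r)) \<le> card {x \<in> Z. insert x (P r) \<notin> \<I>} + card (Z - Q r)" by linarith
    moreover have "real (card {x \<in> Z. insert x (P r) \<notin> \<I>}) \<le> p * card (P r)"
      by (rule p_system_card_blocked[OF M p PI Z])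
    moreover have "p * card (P r) \<le> p * r"
      using card_P p_system_nonneg[OF M p] by (intro mult_left_mono) auto
    ultimately show ?thesis using taken[OF that] by (simp add: algebra_simps)
  qed
  \<comment> \<open>The sum is built in layers: elements of \<open>U (Suc s) - U s\<close> were
    still candidates at step \<open>s\<close>, so each is charged to
    \<open>\<delta> s\<close>.\<close>
  have "(\<Sum>x\<in>U s. marginal f x (P R)) \<le> (\<Sum>r<s. (real (card (U (Suc r))) - card (U r)) * \<delta> r)"
    if "s \<le> R" for s
    using that
  proof (induction s)
    case 0
    then show ?case by (simp add: U_0)
  next
    case (Suc s)
    have "marginal f x (P R) \<le> \<delta> s" if "x \<in> U (Suc s) - U s" for x
    proof -
      have x: "x \<in> A s" using that by (auto simp: U_def)
      have "marginal f x (P R) \<le> marginal f x (P s)"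
        using x AM Pmono[of s R] PM Suc.prems
        by (intro submodular_on_marginal_antimono[OF sm mono]) auto
      also have "\<dots> \<le> \<delta> s" using x by (rule gain)
      finally show ?thesis .
    qed
    then have "(\<Sum>x\<in>U (Suc s) - U s. marginal f x (P R)) \<le> card (U (Suc s) - U s) * \<delta> s"
      by (rule sum_bounded_above)
    also have "real (card (U (Suc s) - U s)) = real (card (U (Suc s))) - card (U s)"
      using U_mono finU by (simp add: card_Diff_subset card_mono)
    finally show ?case
      using Suc sum.subset_diff[OF U_mono finU, of "\<lambda>x. marginal f x (P R)" s] by simp
  qed
  from this[of R] have "(\<Sum>x\<in>Z. marginal f x (P R))
      \<le> (\<Sum>r<R. (real (card (U (Suc r))) - card (U r)) * \<delta> r)"
    by (simp add: U_R)
  also have "\<dots> \<le> (p + 1) * (\<Sum>r<R. \<delta> r)"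
    using U_card \<delta>_dec \<delta>_nonneg by (intro sum_by_parts_le) (auto simp: U_0)
  finally have "(\<Sum>x\<in>Z. marginal f x (P R)) \<le> (p + 1) * f (P R)" by (simp add: sum_\<delta>)
  moreover have "f Z \<le> f (P R \<union> Z)"
    using PM OM by (intro mono_onD[OF mono]) auto
  moreover have "f (P R \<union> Z) \<le> f (P R) + (\<Sum>x\<in>Z. marginal f x (P R))"
    by (rule submodular_on_le_sum_marginal[OF sm mono finO PM OM])
  ultimately show ?thesis by (simp add: algebra_simps)
qed

section \<open>Runs of the protocol and the picks of one agent\<close>

lemma length_run [simp]: "length (run n \<pi> t) = t"
  by (induction t) auto

lemma set_run: "set (run n \<pi> t) = (\<lambda>s. \<pi> (turn_agent n s) (run n \<pi> s)) ` {..<t}"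
  by (induction t) (auto simp: lessThan_Suc)

lemma picks_run_Suc:
  "picks n k (run n \<pi> (Suc t)) = picks n k (run n \<pi> t) @
     (if turn_agent n t = k then (case \<pi> k (run n \<pi> t) of None \<Rightarrow> [] | Some x \<Rightarrow> [x]) else [])"
  by (auto simp: picks_def nths_append split: option.split)

lemma set_picks_run:
  "set (picks n k (run n \<pi> t)) = {x. \<exists>s<t. turn_agent n s = k \<and> \<pi> k (run n \<pi> s) = Some x}"
proof (induction t)
  case 0
  then show ?case by (simp add: picks_def)
next
  case (Suc t)
  have "x \<in> set (picks n k (run n \<pi> (Suc t))) \<longleftrightarrow>
      x \<in> set (picks n k (run n \<pi> t)) \<or> turn_agent n t = k \<and> \<pi> k (run n \<pi> t) = Some x" for x
    unfolding picks_run_Suc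
    by (cases "turn_agent n t = k"; cases "\<pi> k (run n \<pi> t)") (simp_all, auto)
  then show ?case
    unfolding Suc.IH less_Suc_eq by blast
qed

text \<open>Agent \<open>k\<close> moves only at offset \<open>k - 1\<close> of a round. A general
  offset \<open>d\<close> allows looking at its picks in the middle of a round, when another agent
  moves.\<close>

lemma picks_run_within_round:
  assumes "k \<in> {1..n}" and "d \<le> n"
  shows "picks n k (run n \<pi> (r * n + d)) = picks n k (run n \<pi> (r * n)) @
    (if k \<le> d then (case \<pi> k (run n \<pi> (r * n + (k - 1))) of None \<Rightarrow> [] | Some x \<Rightarrow> [x]) else [])"
  using assms(2)
proof (induction d)
  case 0
  then show ?case using assms(1) by simp
next
  case (Suc d)
  then have "turn_agent n (r * n + d) = Suc d" by (simp add: turn_agent_def)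
  then show ?case
    using Suc picks_run_Suc[of n k \<pi> "r * n + d"] by (auto simp del: run.simps)
qed

lemma picks_run_round:
  assumes "k \<in> {1..n}"
  shows "picks n k (run n \<pi> (Suc r * n)) = picks n k (run n \<pi> (r * n)) @
    (case \<pi> k (run n \<pi> (r * n + (k - 1))) of None \<Rightarrow> [] | Some x \<Rightarrow> [x])"
  using picks_run_within_round[OF assms, of n \<pi> r] assms by (simp add: add.commute)

lemma length_picks_run_le:
  assumes "k \<in> {1..n}"
  shows "length (picks n k (run n \<pi> (r * n))) \<le> r"
proof (induction r)
  case 0
  then show ?case by (simp add: picks_def)
next
  case (Suc r)
  then show ?case by (auto simp only: picks_run_round[OF assms]) (auto split: option.split)
qed

lemma picks_run_prefix:
  assumes "s \<le> t"
  shows "\<exists>ys. picks n k (run n \<pi> t) = picks n k (run n \<pi> s) @ ys"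
  using assms by (induction t rule: dec_induct) (auto simp: picks_run_Suc simp del: run.simps)

text \<open>Picks are only ever appended, so one of the two lists is a prefix of the other.\<close>

lemma hd_picks_run_eq:
  assumes "picks n k (run n \<pi> s) \<noteq> []" and "picks n k (run n \<pi> t) \<noteq> []"
  shows "hd (picks n k (run n \<pi> s)) = hd (picks n k (run n \<pi> t))"
  using assms picks_run_prefix[of s t n k \<pi>] picks_run_prefix[of t s n k \<pi>]
  by (metis hd_append2 nle_le)

lemma run_select_unique:
  assumes "n > 0" and adm: "\<forall>k \<in> {1..n}. admissible_policy M (\<pi> k)"
    and "\<pi> (turn_agent n s) (run n \<pi> s) = Some x" and "\<pi> (turn_agent n t) (run n \<pi> t) = Some x"
  shows "s = t"
proof -
  have fresh: "\<pi> (turn_agent n v) (run n \<pi> v) \<noteq> Some x"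
    if "u < v" and "\<pi> (turn_agent n u) (run n \<pi> u) = Some x" for u v
  proof
    assume v: "\<pi> (turn_agent n v) (run n \<pi> v) = Some x"
    have "turn_agent n v \<in> {1..n}" using assms(1) by (simp add: turn_agent_def Suc_leI)
    with adm have "admissible_policy M (\<pi> (turn_agent n v))" by blast
    with v have "x \<in> available M (run n \<pi> v)"
      unfolding admissible_policy_def by (metis option.distinct(1) option.inject)
    moreover have "Some x \<in> set (run n \<pi> v)"
      unfolding set_run using that by force
    ultimately show False by (simp add: available_def)
  qed
  then show ?thesis using assms(3,4) by (metis linorder_neqE_nat)
qed

text \<open>Since only one turn selects \<open>x\<close>, an item that agent \<open>k\<close> picks
  at some time and that is gone by time \<open>s\<close> was removed by \<open>k\<close>
  itself.\<close>

lemma selected_item_in_picks: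
  assumes "n > 0" and "\<forall>k \<in> {1..n}. admissible_policy M (\<pi> k)"
    and "x \<in> set (picks n k (run n \<pi> t))" and "Some x \<in> set (run n \<pi> s)"
  shows "x \<in> set (picks n k (run n \<pi> s))"
  using assms(3,4) run_select_unique[OF assms(1,2)]
  unfolding set_picks_run set_run by (auto, metis)

section \<open>The protocol as a greedy sequence\<close>

theorem theorem4:
  fixes M :: "'a set" and n i j :: nat and p :: real
    and f :: "'a set \<Rightarrow> real" and \<I> :: "'a set set"
    and \<pi> :: "nat \<Rightarrow> 'a policy"
    and S\<^sub>i S\<^sub>j S\<^sub>j' :: "'a set" and g :: 'a
  assumes "finite M"
    and "i \<in> {1..n}" and "j \<in> {1..n}" and "i \<noteq> j"
    and "f {} = 0"
    and "\<forall>S \<subseteq> M. f S \<ge> 0"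
    and "mono_on (Pow M) f"
    and "submodular_on M f"
    and "p_system M p \<I>"
    and "\<forall>k \<in> {1..n}. admissible_policy M (\<pi> k)"
    and "greedy_policy M n f \<I> i (\<pi> i)"
    and "S\<^sub>i = set (picks n i (round_robin M n \<pi>))"
    and "S\<^sub>j = set (picks n j (round_robin M n \<pi>))"
    and "S\<^sub>j \<noteq> {} \<longrightarrow> g = hd (picks n j (round_robin M n \<pi>))"
    and "S\<^sub>j' = (if i < j then S\<^sub>j else S\<^sub>j - {g})"
  shows "f S\<^sub>i \<ge> (MAX S\<in>restrict_system \<I> S\<^sub>j'. f S) / (p + 2)"
proof -
  define R where "R = num_rounds M n"
  \<comment> \<open>\<open>h r\<close> is the history agent \<open>i\<close> sees at its turn in the
    round with 0-based index \<open>r\<close>. Its own picks are still those from the start of the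
    round, whereas earlier agents have already moved.\<close>
  define h where "h r = run n \<pi> (r * n + (i - 1))" for r
  define P where "P r = set (picks n i (run n \<pi> (r * n)))" for r
  define Q where "Q r = available M (h r)" for r
  have n: "n > 0" using assms(2) by auto
  have Si: "S\<^sub>i = P R" and Sj: "S\<^sub>j = set (picks n j (run n \<pi> (R * n)))"
    using assms(12,13) by (simp_all add: P_def R_def round_robin_def)
  have g: "g = hd (picks n j (run n \<pi> (R * n)))" if "S\<^sub>j \<noteq> {}"
    using assms(14) that by (simp add: R_def round_robin_def)
  have ind: "independence_system M \<I>" using assms(9) by (simp add: p_system_def)
  have p0: "0 \<le> p" by (rule p_system_nonneg[OF assms(1,9)])
  have picks_h: "set (picks n i (h r)) = P r" for r
  proof -
    have "i - 1 \<le> n" "\<not> i \<le> i - 1" using assms(2) by auto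
    then show ?thesis
      using picks_run_within_round[OF assms(2), of "i - 1" \<pi> r] by (simp add: h_def P_def)
  qed
  have greedy: "if {x \<in> Q r. insert x (P r) \<in> \<I>} \<noteq> {}
      then \<exists>x. is_arg_max (\<lambda>y. marginal f y (P r)) (\<lambda>y. y \<in> {x \<in> Q r. insert x (P r) \<in> \<I>}) x
        \<and> \<pi> i (h r) = Some x
      else \<pi> i (h r) = None" for r
    using assms(11)[unfolded greedy_policy_def, rule_format, of "h r"]
    unfolding Let_def picks_h Q_def[symmetric] Un_insert_right Un_empty_right .
  have P_Suc: "P (Suc r) = P r \<union> (case \<pi> i (h r) of None \<Rightarrow> {} | Some x \<Rightarrow> {x})" for r
    unfolding P_def picks_run_round[OF assms(2)] h_def by (auto split: option.split)
  have "f X \<le> (p + 2) * f S\<^sub>i" if X: "X \<in> \<I>" "X \<subseteq> S\<^sub>j'" for X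
    unfolding Si
  \<comment> \<open>\<open>run\<close> is defined for any number of turns, so the conditions on
    \<open>P\<close> and \<open>Q\<close> hold for all \<open>r\<close>, also past the last
    round.\<close>
  proof (rule greedy_sequence_bound[OF assms(1,5,7,8,9), where P = P and Q = Q])
    show "P 0 = {}" by (simp add: P_def picks_def)
    show "Q r \<subseteq> M" for r by (auto simp: Q_def available_def)
    show "Q (Suc r) \<subseteq> Q r" for r
      by (force simp: Q_def available_def h_def set_run)
    show "P (Suc r) = P r" if "{x \<in> Q r. insert x (P r) \<in> \<I>} = {}" for r
      using greedy[of r] that by (simp add: P_Suc)
    show "\<exists>x. P (Suc r) = insert x (P r) \<and>
        is_arg_max (\<lambda>y. marginal f y (P r)) (\<lambda>y. y \<in> {x \<in> Q r. insert x (P r) \<in> \<I>}) x"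
      if "{x \<in> Q r. insert x (P r) \<in> \<I>} \<noteq> {}" for r
    proof -
      from greedy[of r, unfolded if_P[OF that]] obtain x where
        "is_arg_max (\<lambda>y. marginal f y (P r)) (\<lambda>y. y \<in> {x \<in> Q r. insert x (P r) \<in> \<I>}) x"
        "\<pi> i (h r) = Some x" by blast
      then show ?thesis by (intro exI[of _ x]) (simp add: P_Suc)
    qed
    show "X \<in> \<I>" by (rule X)
    have XSj: "X \<subseteq> S\<^sub>j" using X(2) assms(15) by (auto split: if_splits)
    \<comment> \<open>\<open>h R\<close> extends the final history of the protocol, so it records
      every item of \<open>S\<^sub>j\<close>.\<close>
    show "X \<inter> Q R = {}"
    proof -
      have "Some x \<in> set (h R)" if "x \<in> X" for x
      proof -
        from that XSj obtain s where "s < R * n" "\<pi> (turn_agent n s) (run n \<pi> s) = Some x"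
          unfolding Sj set_picks_run by auto
        then show ?thesis
          unfolding h_def set_run by (intro image_eqI[of _ _ s]) auto
      qed
      then show ?thesis by (auto simp: Q_def available_def)
    qed
    show "card (X - Q r) \<le> r" for r
    proof -
      let ?L = "\<lambda>r. picks n j (run n \<pi> (r * n))"
      have XM: "X \<subseteq> M" using X(1) ind by (auto simp: independence_system_def)
      have taken: "X - Q r \<subseteq> set (picks n j (h r))"
        using XM XSj selected_item_in_picks[OF n assms(10)]
        unfolding Sj Q_def available_def h_def by blast
      show ?thesis
      proof (cases "i < j")
        \<comment> \<open>Agent \<open>j\<close> moves after \<open>i\<close>, so it has had only
          \<open>r\<close> turns when \<open>i\<close> moves.\<close>
        case True
        then have "picks n j (h r) = ?L r"
          using assms(2) picks_run_within_round[OF assms(3), of "i - 1" \<pi> r] by (auto simp: h_def)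
        then have "X - Q r \<subseteq> set (?L r)" using taken by simp
        then have "card (X - Q r) \<le> length (?L r)"
          by (meson List.finite_set card_length card_mono le_trans)
        then show ?thesis using length_picks_run_le[OF assms(3), of \<pi> r] by simp
      next
        case False
        \<comment> \<open>Agent \<open>j\<close> has already had \<open>Suc r\<close> turns;
          excluding \<open>g\<close> brings the count back to \<open>r\<close>.\<close>
        then have "j \<le> i - 1" using assms(4) by auto
        then have "picks n j (h r) = ?L (Suc r)"
          using assms(2) picks_run_within_round[OF assms(3), of "i - 1" \<pi> r]
          unfolding picks_run_round[OF assms(3)] by (auto simp: h_def)
        then have sub: "X - Q r \<subseteq> set (?L (Suc r)) - {g}"
          using taken X(2) False assms(15) by auto
        \<comment> \<open>Only when some item is missing is the list of picks known to be nonempty,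
          which identifies \<open>g\<close> as its head; the rest then lies in the tail.\<close>
        show ?thesis
        proof (cases "X - Q r = {}")
          case True
          then show ?thesis by (simp only: card.empty)
        next
          case False
          then have ne: "?L (Suc r) \<noteq> []" "?L R \<noteq> []" "S\<^sub>j \<noteq> {}"
            using sub XSj Sj by auto
          then have "g = hd (?L (Suc r))"
            using g hd_picks_run_eq by metis
          then have "X - Q r \<subseteq> set (tl (?L (Suc r)))"
            using sub ne(1) by (cases "?L (Suc r)") auto
          then have "card (X - Q r) \<le> length (tl (?L (Suc r)))"
            by (meson List.finite_set card_length card_mono le_trans)
          then show ?thesis using length_picks_run_le[OF assms(3), of \<pi> "Suc r"] by simp
        qed
      qed
    qed
  qed
  \<comment> \<open>Downward closure makes every trace on \<open>S\<^sub>j'\<close> independent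
    itself.\<close>
  moreover have "restrict_system \<I> S\<^sub>j' \<subseteq> {X \<in> \<I>. X \<subseteq> S\<^sub>j'}"
    using ind by (auto simp: restrict_system_def independence_system_def)
  moreover have "finite (restrict_system \<I> S\<^sub>j')" "restrict_system \<I> S\<^sub>j' \<noteq> {}"
    using ind assms(1)
    by (auto simp: restrict_system_def independence_system_def Setcompr_eq_image
        intro: finite_subset[of \<I> "Pow M"])
  ultimately have "(MAX S\<in>restrict_system \<I> S\<^sub>j'. f S) \<le> (p + 2) * f S\<^sub>i"
    by (subst Max_le_iff) auto
  then show ?thesis using p0 by (simp add: divide_le_eq mult.commute)
qed

end
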